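(* Let $x_0,\dots,x_{n-1}$, $y_0,\dots,y_{n-1}$ be variables and $\vec{z}=(z_0,\dots,z_{l-1})$ a tuple of variables. Then $$\bigwedge_{i<n}=\!(x_i\vec{z},y_i)\ \vdash\ \bigwedge_{I\subseteq n}\{x_i \mid i\notin I\}\perp_{\{x_i \mid i\in I\}\vec{z}}\{y_i \mid i\in I\},$$ where $n$ is identified with $\{0,\dots,n-1\}$ and $\vdash$ is derivability by the rules listed in the context.
   Context: Syntax. Variables have sorts in $\mathbb{N}$. A vocabulary $\tau$ consists of a set $S_\tau\subseteq\mathbb{N}$ of sorts and sorted relation symbols. Formulas of independence logic are built from literals ($u=v$, $R(\vec{x})$ and their negations) and independence atoms $\vec{y}\perp_{\vec{x}}\vec{z}$ (finite, possibly empty, tuples of variables) by $\wedge,\vee,\exists,\forall$ and the new-sort quantifiers $\tilde\exists v,\tilde\forall v$, where $\tilde\exists v\varphi$, $\tilde\forall v\varphi$ are $\tau$-formulas when $\mathrm{sort}(v)\notin S_\tau$ and $\varphi$ is a formula of $\tau$ enlarged by the sort $\mathrm{sort}(v)$ in which no variable of that sort other than $v$ is free. $=\!(\vec{x},\vec{y})$ abbreviates $\vec{y}\perp_{\vec{x}}\vec{y}$. Dependence logic is the fragment in which only independence atoms of the form $\vec{y}\perp_{\vec{x}}\vec{y}$ occur. Juxtaposition of tuples is concatenation, and a finite set of indexed variables inside an atom is read as a tuple listing it. Rules. $\Sigma\vdash\psi$ is the least relation (between sets of formulas and formulas of a common vocabulary), closed under the usual structural rules (assumption, weakening, cut), given by: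 (I) Independence atom: Constancy: $\vec{y}\perp_{\vec{x}}\vec{y}$ entails $\vec{y}\perp_{\vec{x}}\vec{z}$. Reflexivity: $\vec{x}\perp_{\vec{x}}\vec{y}$. Symmetry: $\vec{z}\perp_{\vec{x}}\vec{y}$ entails $\vec{y}\perp_{\vec{x}}\vec{z}$. Weakening: $\vec{y}y'\perp_{\vec{x}}\vec{z}z'$ entails $\vec{y}\perp_{\vec{x}}\vec{z}$. Permutation: each of the three tuples may be permuted. Fixed Parameter: $\vec{z}\perp_{\vec{x}}\vec{y}$ entails $\vec{y}\vec{x}\perp_{\vec{x}}\vec{z}\vec{x}$. First Transitivity: $\vec{x}\perp_{\vec{z}}\vec{y}\wedge\vec{u}\perp_{\vec{z}\vec{x}}\vec{y}$ entails $\vec{u}\perp_{\vec{z}}\vec{y}$. Second Transitivity: $\vec{y}\perp_{\vec{z}}\vec{y}\wedge\vec{z}\vec{x}\perp_{\vec{y}}\vec{u}$ entails $\vec{x}\perp_{\vec{z}}\vec{u}$. Exchange: $\vec{x}\perp_{\vec{z}}\vec{y}\wedge\vec{x}\vec{y}\perp_{\vec{z}}\vec{u}$ entails $\vec{x}\perp_{\vec{z}}\vec{y}\vec{u}$. (II) Dependence atom: $=\!(\vec{x}\vec{y},\vec{x})$; $=\!(\vec{x},\vec{y})\wedge=\!(\vec{y},\vec{z})$ entails $=\!(\vec{x},\vec{z})$; $=\!(\vec{x},\vec{y})$ entails $=\!(\vec{x},\vec{x}\vec{y})$; both tuples may be permuted. (III) Semigraphoid axioms: $\vec{x}\perp_{\vec{z}}\emptyset$;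 Symmetry; $\vec{x}\perp_{\vec{z}}\vec{y}\vec{w}$ entails $\vec{x}\perp_{\vec{z}}\vec{y}$ (Decomposition) and entails $\vec{x}\perp_{\vec{z}\vec{w}}\vec{y}$ (Weak Union); $\vec{x}\perp_{\vec{z}}\vec{y}\wedge\vec{x}\perp_{\vec{z}\vec{y}}\vec{w}$ entails $\vec{x}\perp_{\vec{z}}\vec{y}\vec{w}$ (Contraction); Permutation; $\vec{x}\perp_{\vec{z}}\vec{y}$ entails $\vec{x}\vec{x}\perp_{\vec{z}\vec{z}}\vec{y}\vec{y}$ (Repetition). (IV) Logical rules: ($\exists$-elimination) if $\Sigma\cup\{\varphi\}\vdash\psi$ and $x$ is not free in $\psi$ or in any member of $\Sigma$, then $\Sigma\cup\{\exists x\varphi\}\vdash\psi$. ($\exists$-introduction) if $y$ has the same sort as $x$ and no free occurrence of $x$ in $\varphi$ lies in the scope of a quantifier $Qy$, then $\varphi(y/x)$ entails $\exists x\varphi$. ($\wedge$) $\varphi\wedge\psi$ entails $\varphi$ and $\psi$; $\{\varphi,\psi\}$ entails $\varphi\wedge\psi$. (Dependence introduction) $\exists x\varphi$ entails $\exists x(=\!(\vec{z},x)\wedge\varphi)$ whenever $\varphi$ is a formula of dependence logic and $\vec{z}$ lists the free variables of $\exists x\varphi$. (First $\tilde\exists$-introduction) if no variable of sort $\mathrm{sort}(x)$ occurs in any formula of $\Sigma$ and $\Sigma\vdash\exists x\varphi$, then $\Sigma\vdash\tilde\exists x\varphi$. (Second $\tilde\exists$-introduction) if no variable of sort $\mathrm{sort}(x)$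 occurs in any formula of $\Sigma$ and $\Sigma\cup\{\exists x\varphi\}\vdash\exists y\psi$, where $\mathrm{sort}(y)=\mathrm{sort}(x)$, then $\Sigma\cup\{\tilde\exists x\varphi\}\vdash\tilde\exists y\psi$. *)

theory Defs
  imports Main "HOL-Library.Multiset"
begin

datatype variable = Var (sort_of: nat) (idx: nat)

datatype 'r relsym = RelSym (rel_name: 'r) (rel_sorts: "nat list")

record 'r vocab =
  sorts :: "nat set"
  rels :: "'r relsym set"

definition vocabulary :: "'r vocab \<Rightarrow> bool" where
  "vocabulary \<tau> \<longleftrightarrow> (\<forall>R\<in>rels \<tau>. set (rel_sorts R) \<subseteq> sorts \<tau>)"

definition add_sort :: "nat \<Rightarrow> 'r vocab \<Rightarrow> 'r vocab" where
  "add_sort s \<tau> = \<tau>\<lparr>sorts := insert s (sorts \<tau>)\<rparr>"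

text \<open>The conditioning tuple of an independence atom is the middle argument (the subscript).
  \<open>NewEx\<close> and \<open>NewAll\<close> are the new-sort quantifiers, written with a tilde on paper.\<close>

datatype 'r fm =
    Eq variable variable
  | Neq variable variable
  | Rel "'r relsym" "variable list"
  | NRel "'r relsym" "variable list"
  | Indep "variable list" "variable list" "variable list"  ("_ \<bottom>\<^bsub>_\<^esub> _" [61, 0, 61] 60)
  | And "'r fm" "'r fm"  (infixr "\<^bold>\<and>" 55)
  | Or "'r fm" "'r fm"  (infixr "\<^bold>\<or>" 54)
  | Ex variable "'r fm"
  | All variable "'r fm"
  | NewEx variable "'r fm"
  | NewAll variable "'r fm"

abbreviation Dep :: "variable list \<Rightarrow> variable list \<Rightarrow> 'r fm" where
  "Dep xs ys \<equiv> ys \<bottom>\<^bsub>xs\<^esub> ys"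

text \<open>Conjunction of a list of formulas, bracketed to the right. There is no constant for truth in
  the language; the conjunction of no formulas is the atom with three empty tuples, which holds
  in every team.\<close>

fun Conj :: "'r fm list \<Rightarrow> 'r fm" where
  "Conj [] = [] \<bottom>\<^bsub>[]\<^esub> []"
| "Conj [\<phi>] = \<phi>"
| "Conj (\<phi> # \<psi> # \<phi>s) = \<phi> \<^bold>\<and> Conj (\<psi> # \<phi>s)"

primrec free_vars :: "'r fm \<Rightarrow> variable set" where
  "free_vars (Eq u v) = {u, v}"
| "free_vars (Neq u v) = {u, v}"
| "free_vars (Rel R us) = set us"
| "free_vars (NRel R us) = set us"
| "free_vars (ys \<bottom>\<^bsub>xs\<^esub> zs) = set ys \<union> set xs \<union> set zs"
| "free_vars (\<phi> \<^bold>\<and> \<psi>) = free_vars \<phi> \<union> free_vars \<psi>"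
| "free_vars (\<phi> \<^bold>\<or> \<psi>) = free_vars \<phi> \<union> free_vars \<psi>"
| "free_vars (Ex v \<phi>) = free_vars \<phi> - {v}"
| "free_vars (All v \<phi>) = free_vars \<phi> - {v}"
| "free_vars (NewEx v \<phi>) = free_vars \<phi> - {v}"
| "free_vars (NewAll v \<phi>) = free_vars \<phi> - {v}"

primrec vars :: "'r fm \<Rightarrow> variable set" where
  "vars (Eq u v) = {u, v}"
| "vars (Neq u v) = {u, v}"
| "vars (Rel R us) = set us"
| "vars (NRel R us) = set us"
| "vars (ys \<bottom>\<^bsub>xs\<^esub> zs) = set ys \<union> set xs \<union> set zs"
| "vars (\<phi> \<^bold>\<and> \<psi>) = vars \<phi> \<union> vars \<psi>"
| "vars (\<phi> \<^bold>\<or> \<psi>) = vars \<phi> \<union> vars \<psi>"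
| "vars (Ex v \<phi>) = insert v (vars \<phi>)"
| "vars (All v \<phi>) = insert v (vars \<phi>)"
| "vars (NewEx v \<phi>) = insert v (vars \<phi>)"
| "vars (NewAll v \<phi>) = insert v (vars \<phi>)"

primrec formula :: "'r vocab \<Rightarrow> 'r fm \<Rightarrow> bool" where
  "formula \<tau> (Eq u v) \<longleftrightarrow> {sort_of u, sort_of v} \<subseteq> sorts \<tau>"
| "formula \<tau> (Neq u v) \<longleftrightarrow> {sort_of u, sort_of v} \<subseteq> sorts \<tau>"
| "formula \<tau> (Rel R us) \<longleftrightarrow> R \<in> rels \<tau> \<and> map sort_of us = rel_sorts R"
| "formula \<tau> (NRel R us) \<longleftrightarrow> R \<in> rels \<tau> \<and> map sort_of us = rel_sorts R"
| "formula \<tau> (ys \<bottom>\<^bsub>xs\<^esub> zs) \<longleftrightarrow> sort_of ` (set ys \<union> set xs \<union> set zs) \<subseteq> sorts \<tau>"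
| "formula \<tau> (\<phi> \<^bold>\<and> \<psi>) \<longleftrightarrow> formula \<tau> \<phi> \<and> formula \<tau> \<psi>"
| "formula \<tau> (\<phi> \<^bold>\<or> \<psi>) \<longleftrightarrow> formula \<tau> \<phi> \<and> formula \<tau> \<psi>"
| "formula \<tau> (Ex v \<phi>) \<longleftrightarrow> sort_of v \<in> sorts \<tau> \<and> formula \<tau> \<phi>"
| "formula \<tau> (All v \<phi>) \<longleftrightarrow> sort_of v \<in> sorts \<tau> \<and> formula \<tau> \<phi>"
| "formula \<tau> (NewEx v \<phi>) \<longleftrightarrow> sort_of v \<notin> sorts \<tau> \<and> formula (add_sort (sort_of v) \<tau>) \<phi> \<and>
     (\<forall>u\<in>free_vars \<phi>. sort_of u = sort_of v \<longrightarrow> u = v)"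
| "formula \<tau> (NewAll v \<phi>) \<longleftrightarrow> sort_of v \<notin> sorts \<tau> \<and> formula (add_sort (sort_of v) \<tau>) \<phi> \<and>
     (\<forall>u\<in>free_vars \<phi>. sort_of u = sort_of v \<longrightarrow> u = v)"

primrec dependence_logic :: "'r fm \<Rightarrow> bool" where
  "dependence_logic (Eq u v) \<longleftrightarrow> True"
| "dependence_logic (Neq u v) \<longleftrightarrow> True"
| "dependence_logic (Rel R us) \<longleftrightarrow> True"
| "dependence_logic (NRel R us) \<longleftrightarrow> True"
| "dependence_logic (ys \<bottom>\<^bsub>xs\<^esub> zs) \<longleftrightarrow> ys = zs"
| "dependence_logic (\<phi> \<^bold>\<and> \<psi>) \<longleftrightarrow> dependence_logic \<phi> \<and> dependence_logic \<psi>"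
| "dependence_logic (\<phi> \<^bold>\<or> \<psi>) \<longleftrightarrow> dependence_logic \<phi> \<and> dependence_logic \<psi>"
| "dependence_logic (Ex v \<phi>) \<longleftrightarrow> dependence_logic \<phi>"
| "dependence_logic (All v \<phi>) \<longleftrightarrow> dependence_logic \<phi>"
| "dependence_logic (NewEx v \<phi>) \<longleftrightarrow> dependence_logic \<phi>"
| "dependence_logic (NewAll v \<phi>) \<longleftrightarrow> dependence_logic \<phi>"

definition subst_var :: "variable \<Rightarrow> variable \<Rightarrow> variable \<Rightarrow> variable" where
  "subst_var y x u = (if u = x then y else u)"

text \<open>\<open>subst y x \<phi>\<close> replaces the free occurrences of \<open>x\<close> by \<open>y\<close>, on paper \<open>\<phi>(y/x)\<close>.\<close>

primrec subst :: "variable \<Rightarrow> variable \<Rightarrow> 'r fm \<Rightarrow> 'r fm" where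
  "subst y x (Eq u v) = Eq (subst_var y x u) (subst_var y x v)"
| "subst y x (Neq u v) = Neq (subst_var y x u) (subst_var y x v)"
| "subst y x (Rel R us) = Rel R (map (subst_var y x) us)"
| "subst y x (NRel R us) = NRel R (map (subst_var y x) us)"
| "subst y x (us \<bottom>\<^bsub>vs\<^esub> ws) =
     map (subst_var y x) us \<bottom>\<^bsub>map (subst_var y x) vs\<^esub> map (subst_var y x) ws"
| "subst y x (\<phi> \<^bold>\<and> \<psi>) = subst y x \<phi> \<^bold>\<and> subst y x \<psi>"
| "subst y x (\<phi> \<^bold>\<or> \<psi>) = subst y x \<phi> \<^bold>\<or> subst y x \<psi>"
| "subst y x (Ex v \<phi>) = Ex v (if v = x then \<phi> else subst y x \<phi>)"
| "subst y x (All v \<phi>) = All v (if v = x then \<phi> else subst y x \<phi>)"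
| "subst y x (NewEx v \<phi>) = NewEx v (if v = x then \<phi> else subst y x \<phi>)"
| "subst y x (NewAll v \<phi>) = NewAll v (if v = x then \<phi> else subst y x \<phi>)"

text \<open>\<open>free_for y x \<phi>\<close>: no free occurrence of \<open>x\<close> in \<open>\<phi>\<close> lies in the scope of a quantifier (of any
  of the four kinds) binding \<open>y\<close>.\<close>

primrec free_for :: "variable \<Rightarrow> variable \<Rightarrow> 'r fm \<Rightarrow> bool" where
  "free_for y x (Eq u v) \<longleftrightarrow> True"
| "free_for y x (Neq u v) \<longleftrightarrow> True"
| "free_for y x (Rel R us) \<longleftrightarrow> True"
| "free_for y x (NRel R us) \<longleftrightarrow> True"
| "free_for y x (us \<bottom>\<^bsub>vs\<^esub> ws) \<longleftrightarrow> True"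
| "free_for y x (\<phi> \<^bold>\<and> \<psi>) \<longleftrightarrow> free_for y x \<phi> \<and> free_for y x \<psi>"
| "free_for y x (\<phi> \<^bold>\<or> \<psi>) \<longleftrightarrow> free_for y x \<phi> \<and> free_for y x \<psi>"
| "free_for y x (Ex v \<phi>) \<longleftrightarrow> v = x \<or> (v = y \<longrightarrow> x \<notin> free_vars \<phi>) \<and> free_for y x \<phi>"
| "free_for y x (All v \<phi>) \<longleftrightarrow> v = x \<or> (v = y \<longrightarrow> x \<notin> free_vars \<phi>) \<and> free_for y x \<phi>"
| "free_for y x (NewEx v \<phi>) \<longleftrightarrow> v = x \<or> (v = y \<longrightarrow> x \<notin> free_vars \<phi>) \<and> free_for y x \<phi>"
| "free_for y x (NewAll v \<phi>) \<longleftrightarrow> v = x \<or> (v = y \<longrightarrow> x \<notin> free_vars \<phi>) \<and> free_for y x \<phi>"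

text \<open>\<open>\<Sigma> \<rhd> \<psi>\<close> collects the rules that do not transform derivations, for arbitrary expressions; \<open>derives\<close>
  below uses only the instances whose formulas share a vocabulary. Symmetry and permutation
  belong both to the rules for independence atoms and to the semigraphoid axioms and are
  listed once. In \<open>ind_weakening\<close> the removed \<open>y'\<close> and \<open>z'\<close> are single variables.\<close>

inductive entails :: "'r fm set \<Rightarrow> 'r fm \<Rightarrow> bool"  (infix "\<rhd>" 50) where
  ind_constancy: "{ys \<bottom>\<^bsub>xs\<^esub> ys} \<rhd> ys \<bottom>\<^bsub>xs\<^esub> zs"
| ind_reflexivity: "{} \<rhd> xs \<bottom>\<^bsub>xs\<^esub> ys"
| ind_symmetry: "{zs \<bottom>\<^bsub>xs\<^esub> ys} \<rhd> ys \<bottom>\<^bsub>xs\<^esub> zs"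
| ind_weakening: "{ys @ [y'] \<bottom>\<^bsub>xs\<^esub> zs @ [z']} \<rhd> ys \<bottom>\<^bsub>xs\<^esub> zs"
| ind_permutation: "mset ys' = mset ys \<Longrightarrow> mset xs' = mset xs \<Longrightarrow> mset zs' = mset zs \<Longrightarrow>
    {ys \<bottom>\<^bsub>xs\<^esub> zs} \<rhd> ys' \<bottom>\<^bsub>xs'\<^esub> zs'"
| ind_fixed_parameter: "{zs \<bottom>\<^bsub>xs\<^esub> ys} \<rhd> ys @ xs \<bottom>\<^bsub>xs\<^esub> zs @ xs"
| ind_first_transitivity: "{(xs \<bottom>\<^bsub>zs\<^esub> ys) \<^bold>\<and> (us \<bottom>\<^bsub>zs @ xs\<^esub> ys)} \<rhd> us \<bottom>\<^bsub>zs\<^esub> ys"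
| ind_second_transitivity: "{(ys \<bottom>\<^bsub>zs\<^esub> ys) \<^bold>\<and> (zs @ xs \<bottom>\<^bsub>ys\<^esub> us)} \<rhd> xs \<bottom>\<^bsub>zs\<^esub> us"
| ind_exchange: "{(xs \<bottom>\<^bsub>zs\<^esub> ys) \<^bold>\<and> (xs @ ys \<bottom>\<^bsub>zs\<^esub> us)} \<rhd> xs \<bottom>\<^bsub>zs\<^esub> ys @ us"

| dep_projection: "{} \<rhd> Dep (xs @ ys) xs"
| dep_transitivity: "{Dep xs ys \<^bold>\<and> Dep ys zs} \<rhd> Dep xs zs"
| dep_extension: "{Dep xs ys} \<rhd> Dep xs (xs @ ys)"
| dep_permutation: "mset xs' = mset xs \<Longrightarrow> mset ys' = mset ys \<Longrightarrow> {Dep xs ys} \<rhd> Dep xs' ys'"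

| sg_triviality: "{} \<rhd> xs \<bottom>\<^bsub>zs\<^esub> []"
| sg_decomposition: "{xs \<bottom>\<^bsub>zs\<^esub> ys @ ws} \<rhd> xs \<bottom>\<^bsub>zs\<^esub> ys"
| sg_weak_union: "{xs \<bottom>\<^bsub>zs\<^esub> ys @ ws} \<rhd> xs \<bottom>\<^bsub>zs @ ws\<^esub> ys"
| sg_contraction: "{(xs \<bottom>\<^bsub>zs\<^esub> ys) \<^bold>\<and> (xs \<bottom>\<^bsub>zs @ ys\<^esub> ws)} \<rhd> xs \<bottom>\<^bsub>zs\<^esub> ys @ ws"
| sg_repetition: "{xs \<bottom>\<^bsub>zs\<^esub> ys} \<rhd> xs @ xs \<bottom>\<^bsub>zs @ zs\<^esub> ys @ ys"

| ex_intro: "sort_of y = sort_of x \<Longrightarrow> free_for y x \<phi> \<Longrightarrow> {subst y x \<phi>} \<rhd> Ex x \<phi>"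
| and_elim1: "{\<phi> \<^bold>\<and> \<psi>} \<rhd> \<phi>"
| and_elim2: "{\<phi> \<^bold>\<and> \<psi>} \<rhd> \<psi>"
| and_intro: "{\<phi>, \<psi>} \<rhd> \<phi> \<^bold>\<and> \<psi>"
| dep_intro: "dependence_logic \<phi> \<Longrightarrow> distinct zs \<Longrightarrow> set zs = free_vars (Ex x \<phi>) \<Longrightarrow>
    {Ex x \<phi>} \<rhd> Ex x (Dep zs [x] \<^bold>\<and> \<phi>)"

definition common_vocab :: "'r fm set \<Rightarrow> 'r fm \<Rightarrow> bool" where
  "common_vocab \<Sigma> \<psi> \<longleftrightarrow> (\<exists>\<tau>. vocabulary \<tau> \<and> (\<forall>\<phi>\<in>insert \<psi> \<Sigma>. formula \<tau> \<phi>))"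

text \<open>The premises \<open>common_vocab\<close> restrict the relation to sets of formulas and formulas that share a
  vocabulary. The vocabulary may change along a derivation, as the introduction rules
  for \<open>NewEx\<close> require.\<close>

inductive derives :: "'r fm set \<Rightarrow> 'r fm \<Rightarrow> bool"  (infix "\<turnstile>" 50) where
  assumption: "\<phi> \<in> \<Sigma> \<Longrightarrow> common_vocab \<Sigma> \<phi> \<Longrightarrow> \<Sigma> \<turnstile> \<phi>"
| weakening: "\<Sigma> \<turnstile> \<psi> \<Longrightarrow> \<Sigma> \<subseteq> \<Gamma> \<Longrightarrow> common_vocab \<Gamma> \<psi> \<Longrightarrow> \<Gamma> \<turnstile> \<psi>"
| cut: "\<Sigma> \<turnstile> \<phi> \<Longrightarrow> \<Sigma> \<union> {\<phi>} \<turnstile> \<psi> \<Longrightarrow> \<Sigma> \<turnstile> \<psi>"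
| entails: "\<Sigma> \<rhd> \<psi> \<Longrightarrow> common_vocab \<Sigma> \<psi> \<Longrightarrow> \<Sigma> \<turnstile> \<psi>"
| ex_elim: "\<Sigma> \<union> {\<phi>} \<turnstile> \<psi> \<Longrightarrow> x \<notin> free_vars \<psi> \<Longrightarrow> (\<And>\<chi>. \<chi> \<in> \<Sigma> \<Longrightarrow> x \<notin> free_vars \<chi>) \<Longrightarrow>
    common_vocab (\<Sigma> \<union> {Ex x \<phi>}) \<psi> \<Longrightarrow> \<Sigma> \<union> {Ex x \<phi>} \<turnstile> \<psi>"
| new_ex_intro1: "\<Sigma> \<turnstile> Ex x \<phi> \<Longrightarrow>
    (\<And>\<chi> v. \<chi> \<in> \<Sigma> \<Longrightarrow> v \<in> vars \<chi> \<Longrightarrow> sort_of v \<noteq> sort_of x) \<Longrightarrow>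
    common_vocab \<Sigma> (NewEx x \<phi>) \<Longrightarrow> \<Sigma> \<turnstile> NewEx x \<phi>"
| new_ex_intro2: "\<Sigma> \<union> {Ex x \<phi>} \<turnstile> Ex y \<psi> \<Longrightarrow> sort_of y = sort_of x \<Longrightarrow>
    (\<And>\<chi> v. \<chi> \<in> \<Sigma> \<Longrightarrow> v \<in> vars \<chi> \<Longrightarrow> sort_of v \<noteq> sort_of x) \<Longrightarrow>
    common_vocab (\<Sigma> \<union> {NewEx x \<phi>}) (NewEx y \<psi>) \<Longrightarrow> \<Sigma> \<union> {NewEx x \<phi>} \<turnstile> NewEx y \<psi>"

lemma derives_common_vocab: "\<Sigma> \<turnstile> \<psi> \<Longrightarrow> common_vocab \<Sigma> \<psi>"
  by (induction rule: derives.induct) (auto simp: common_vocab_def)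

end

theory Submission
  imports Defs
begin

text \<open>The dependence rules combine the given dependence atoms with index in \<open>I\<close> into
  \<open>=(x\<^sub>I z, y\<^sub>I)\<close>. So \<open>y\<^sub>I\<close> is constant given \<open>x\<^sub>I z\<close>, and Constancy followed by Symmetry makes any
  tuple independent of it, in particular the remaining \<open>x\<^sub>i\<close>.\<close>

text \<open>Every rule carries the side condition that its formulas share a vocabulary. With all
  natural numbers as sorts, each independence atom is a formula of \<open>\<tau>\<close>, so for
  atoms these conditions are settled by simplification.\<close>

locale full_vocabulary =
  fixes \<tau> :: "'r vocab" and \<Sigma> :: "'r fm set"
  assumes vocab: "vocabulary \<tau>"
    and all_sorts: "sorts \<tau> = UNIV"
    and formulas: "\<phi> \<in> \<Sigma> \<Longrightarrow> formula \<tau> \<phi>"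
begin

declare all_sorts [simp]

lemma common_vocabI: "(\<And>\<phi>. \<phi> \<in> \<Delta> \<Longrightarrow> formula \<tau> \<phi>) \<Longrightarrow> formula \<tau> \<psi> \<Longrightarrow> common_vocab \<Delta> \<psi>"
  unfolding common_vocab_def using vocab by blast

text \<open>Turns an instance of a basic rule into a step performed under the fixed hypotheses
  \<open>\<Sigma>\<close>: weaken it to \<open>\<Sigma> \<union> \<Delta>\<close>, then cut away the
  members of \<open>\<Delta>\<close>, which is why \<open>\<Delta>\<close> has to be finite.\<close>

lemma derives_entails:
  assumes "\<Delta> \<rhd> \<psi>" "finite \<Delta>" "\<And>\<phi>. \<phi> \<in> \<Delta> \<Longrightarrow> \<Sigma> \<turnstile> \<phi>"
    and "\<And>\<phi>. \<phi> \<in> \<Delta> \<Longrightarrow> formula \<tau> \<phi>" "formula \<tau> \<psi>"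
  shows "\<Sigma> \<turnstile> \<psi>"
proof -
  have "\<Delta> \<turnstile> \<psi>"
    using assms by (intro derives.entails common_vocabI)
  then have "\<Sigma> \<union> \<Delta> \<turnstile> \<psi>"
    using assms formulas by (elim derives.weakening) (auto intro: common_vocabI)
  with \<open>finite \<Delta>\<close> assms(3,4) show ?thesis
  proof (induction \<Delta>)
    case empty
    then show ?case by simp
  next
    case (insert \<phi> \<Delta>)
    \<comment> \<open>Cut needs the same context in both premises, so \<open>\<phi>\<close> is first
      derived from the hypotheses that still remain.\<close>
    have "\<Sigma> \<union> \<Delta> \<turnstile> \<phi>"
    proof (rule derives.weakening)
      show "\<Sigma> \<turnstile> \<phi>"
        using insert.prems(1) by simp
    qed (use insert.prems(2) formulas in \<open>auto intro!: common_vocabI\<close>)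
    moreover have "(\<Sigma> \<union> \<Delta>) \<union> {\<phi>} \<turnstile> \<psi>"
      using insert.prems(3) by simp
    ultimately have "\<Sigma> \<union> \<Delta> \<turnstile> \<psi>"
      by (rule derives.cut)
    with insert show ?case by simp
  qed
qed

lemmas derives_axiom = derives_entails[where \<Delta> = "{}", simplified]
lemmas derives_from = derives_entails[where \<Delta> = "{\<phi>}" for \<phi>, simplified]
lemmas derives_from2 = derives_entails[where \<Delta> = "{\<phi>, \<chi>}" for \<phi> \<chi>, simplified]

lemma derives_And:
  assumes "\<Sigma> \<turnstile> \<phi>" "\<Sigma> \<turnstile> \<psi>" "formula \<tau> \<phi>" "formula \<tau> \<psi>"
  shows "\<Sigma> \<turnstile> \<phi> \<^bold>\<and> \<psi>"
  by (rule derives_from2[OF entails.and_intro]) (use assms in auto)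

lemma formula_Conj: "(\<And>\<phi>. \<phi> \<in> set \<phi>s \<Longrightarrow> formula \<tau> \<phi>) \<Longrightarrow> formula \<tau> (Conj \<phi>s)"
  by (induction \<phi>s rule: Conj.induct) auto

lemma derives_Conj:
  assumes "\<And>\<phi>. \<phi> \<in> set \<phi>s \<Longrightarrow> \<Sigma> \<turnstile> \<phi>" "\<And>\<phi>. \<phi> \<in> set \<phi>s \<Longrightarrow> formula \<tau> \<phi>"
  shows "\<Sigma> \<turnstile> Conj \<phi>s"
  using assms
proof (induction \<phi>s rule: Conj.induct)
  case 1
  \<comment> \<open>The empty conjunction is an atom with three empty tuples, an instance of
    Reflexivity.\<close>
  show ?case
    using derives_axiom[OF entails.ind_reflexivity] by simp
next
  case (3 \<phi> \<psi> \<phi>s)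
  then show ?case
    using formula_Conj[of "\<psi> # \<phi>s"] by (simp add: derives_And)
qed simp

lemma derives_Conj_member:
  assumes "\<Sigma> \<turnstile> Conj \<phi>s" "\<And>\<phi>. \<phi> \<in> set \<phi>s \<Longrightarrow> formula \<tau> \<phi>" "\<phi> \<in> set \<phi>s"
  shows "\<Sigma> \<turnstile> \<phi>"
  using assms
proof (induction \<phi>s rule: Conj.induct)
  case (3 \<chi> \<psi> \<phi>s)
  have *: "\<Sigma> \<turnstile> \<chi> \<^bold>\<and> Conj (\<psi> # \<phi>s)" "formula \<tau> \<chi>" "formula \<tau> (Conj (\<psi> # \<phi>s))"
    using 3 formula_Conj[of "\<psi> # \<phi>s"] by auto
  have "\<Sigma> \<turnstile> \<chi>"
    using derives_from[OF entails.and_elim1 *(1)] * by simp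
  moreover have "\<Sigma> \<turnstile> Conj (\<psi> # \<phi>s)"
    using derives_from[OF entails.and_elim2 *(1)] * by simp
  ultimately show ?case
    using 3 by auto
qed simp_all

lemma Dep_trans: "\<Sigma> \<turnstile> Dep xs ys \<Longrightarrow> \<Sigma> \<turnstile> Dep ys zs \<Longrightarrow> \<Sigma> \<turnstile> Dep xs zs"
  by (rule derives_from[OF entails.dep_transitivity, of ys xs zs]) (simp_all add: derives_And)

lemma Dep_extend: "\<Sigma> \<turnstile> Dep xs ys \<Longrightarrow> \<Sigma> \<turnstile> Dep xs (xs @ ys)"
  by (rule derives_from[OF entails.dep_extension]) simp_all

text \<open>Projection after a rearrangement of \<open>xs\<close> that puts \<open>ys\<close> in
  front. Inclusion of multisets is the right hypothesis, since permuting a tuple preserves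
  multiplicities.\<close>

lemma Dep_subset:
  assumes "mset ys \<subseteq># mset xs"
  shows "\<Sigma> \<turnstile> Dep xs ys"
proof -
  obtain us where "mset us = mset xs - mset ys"
    using ex_mset by blast
  then have "mset xs = mset (ys @ us)"
    using assms by simp
  moreover have "\<Sigma> \<turnstile> Dep (ys @ us) ys"
    by (rule derives_axiom[OF entails.dep_projection]) simp
  ultimately show ?thesis
    using derives_from[OF entails.dep_permutation] by fastforce
qed

text \<open>The chain runs from \<open>xs\<close> to \<open>xs @ ys\<close>, then to
  \<open>xs @ ys @ zs\<close>, then to \<open>ys @ zs\<close>. The middle link is an extension, as
  \<open>xs @ ys\<close> determines \<open>zs\<close> through its part \<open>xs\<close>.\<close>

lemma Dep_append:
  assumes "\<Sigma> \<turnstile> Dep xs ys" "\<Sigma> \<turnstile> Dep xs zs"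
  shows "\<Sigma> \<turnstile> Dep xs (ys @ zs)"
proof -
  have "\<Sigma> \<turnstile> Dep (xs @ ys) xs"
    by (rule Dep_subset) simp
  then have "\<Sigma> \<turnstile> Dep (xs @ ys) ((xs @ ys) @ zs)"
    by (intro Dep_extend Dep_trans[OF _ assms(2)])
  with Dep_extend[OF assms(1)] have "\<Sigma> \<turnstile> Dep xs ((xs @ ys) @ zs)"
    by (rule Dep_trans)
  moreover have "\<Sigma> \<turnstile> Dep ((xs @ ys) @ zs) (ys @ zs)"
    by (rule Dep_subset) simp
  ultimately show ?thesis
    by (rule Dep_trans)
qed

lemma Dep_map: "(\<And>i. i \<in> set I \<Longrightarrow> \<Sigma> \<turnstile> Dep xs [f i]) \<Longrightarrow> \<Sigma> \<turnstile> Dep xs (map f I)"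
proof (induction I)
  case Nil
  show ?case by (simp add: Dep_subset)
next
  case (Cons i I)
  then show ?case
    using Dep_append[where ys = "[f i]" and zs = "map f I"] by simp
qed

lemma Indep_of_Dep:
  assumes "\<Sigma> \<turnstile> Dep xs ys"
  shows "\<Sigma> \<turnstile> us \<bottom>\<^bsub>xs\<^esub> ys"
proof (rule derives_from[OF entails.ind_symmetry])
  show "\<Sigma> \<turnstile> ys \<bottom>\<^bsub>xs\<^esub> us"
    using derives_from[OF entails.ind_constancy assms] by simp
qed simp_all

end

theorem lemma3p14:
  fixes n :: nat and x y :: "nat \<Rightarrow> variable" and z :: "variable list"
  shows "{Conj (map (\<lambda>i. Dep (x i # z) [y i]) [0..<n])} \<turnstile>
    (Conj (map (\<lambda>I. map x (filter (\<lambda>i. i \<notin> set I) [0..<n]) \<bottom>\<^bsub>map x I @ z\<^esub> map y I)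
      (subseqs [0..<n])) :: 'r fm)"
proof -
  let ?\<tau> = "\<lparr>sorts = UNIV, rels = {}\<rparr> :: 'r vocab"
  let ?deps = "map (\<lambda>i. Dep (x i # z) [y i]) [0..<n] :: 'r fm list"
  have "formula ?\<tau> (Conj ?deps)"
    \<comment> \<open>The hypothesis must be known to be a formula before the locale can be
      interpreted with it, so the lemma is taken from the instance without hypotheses.\<close>
    by (rule full_vocabulary.formula_Conj[where \<Sigma> = "{}"])
       (auto simp: full_vocabulary_def vocabulary_def)
  then interpret full_vocabulary ?\<tau> "{Conj ?deps}"
    by unfold_locales (auto simp: vocabulary_def)
  have "{Conj ?deps} \<turnstile> Conj ?deps"
    using formulas by (intro derives.assumption common_vocabI) auto
  then have dep: "{Conj ?deps} \<turnstile> Dep (x i # z) [y i]" if "i < n" for i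
    by (rule derives_Conj_member) (use that in auto)
  \<comment> \<open>The left tuple stays arbitrary; the complementary \<open>x i\<close> enter only
    when the conjuncts are assembled.\<close>
  have "{Conj ?deps} \<turnstile> us \<bottom>\<^bsub>map x I @ z\<^esub> map y I" if "I \<in> set (subseqs [0..<n])" for I us
  proof (rule Indep_of_Dep[OF Dep_map])
    fix i assume i: "i \<in> set I"
    have "set I \<subseteq> {0..<n}"
      using that subseqs_powset[of "[0..<n]"] by auto
    with i have "i < n" by auto
    \<comment> \<open>This holds with multiplicities even if the variables \<open>x i\<close> repeat
      or occur in \<open>z\<close>: \<open>x i\<close> is counted in \<open>map x I\<close>, and
      \<open>z\<close> stands on both sides.\<close>
    have "mset (x i # z) \<subseteq># mset (map x I @ z)"
      using i by auto
    then show "{Conj ?deps} \<turnstile> Dep (map x I @ z) [y i]"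
      using \<open>i < n\<close> by (blast intro: Dep_trans[OF Dep_subset dep])
  qed
  then show ?thesis
    by (intro derives_Conj) auto
qed

end
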